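(* Let $G$ be the Engel group. Then $$\{(-X_3f-X_1X_2f,\,-X_2^2f)\mid f\in\mathcal C^\infty(G)\}=\{(g,h)\in\mathcal C^\infty(G)\times\mathcal C^\infty(G)\mid X_2g=X_1h\}.$$
   Context: The Engel group $G$ is the connected, simply connected Lie group whose Lie algebra has a basis $X_1,X_2,X_3,X_4$ with only non-zero brackets $[X_1,X_2]=X_3$ and $[X_1,X_3]=X_4$. The $X_i$ are regarded as left-invariant vector fields on $G$, acting on real-valued smooth functions. *)

theory Defs
  imports "HOL-Analysis.Analysis"
begin

section \<open>Smooth functions\<close>

text \<open>On a finite-dimensional space, \<open>f\<close> is of class \<open>C\<^sup>k\<^sup>+\<^sup>1\<close> iff it is differentiable and all its
  directional derivatives are of class \<open>C\<^sup>k\<close>.\<close>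

fun C_k :: "nat \<Rightarrow> ('a::euclidean_space \<Rightarrow> real) \<Rightarrow> bool" where
  "C_k 0 f \<longleftrightarrow> continuous_on UNIV f"
| "C_k (Suc k) f \<longleftrightarrow>
     (\<forall>x. f differentiable (at x)) \<and> (\<forall>v. C_k k (\<lambda>x. frechet_derivative f (at x) v))"

definition smooth :: "('a::euclidean_space \<Rightarrow> real) \<Rightarrow> bool" where
  "smooth f \<longleftrightarrow> (\<forall>k. C_k k f)"


section \<open>The Engel group\<close>

text \<open>A connected, simply connected nilpotent Lie group is determined up to isomorphism by its Lie
  algebra, and its exponential map is a diffeomorphism.  The Engel group is realised here in
  exponential coordinates: the underlying manifold is the Lie algebra \<open>\<real>\<^sup>4\<close> itself,
  \<open>X\<^sub>i = axis i 1\<close>, the multiplication is given by the Baker-Campbell-Hausdorff formula, and the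
  exponential map is the identity.\<close>

type_synonym engel = "real^4"

definition engel_bracket :: "engel \<Rightarrow> engel \<Rightarrow> engel" where
  "engel_bracket x y = vector [0, 0, x$1 * y$2 - x$2 * y$1, x$1 * y$3 - x$3 * y$1]"

text \<open>All brackets of four or more elements vanish, so the series stops at order three.\<close>

definition engel_mult :: "engel \<Rightarrow> engel \<Rightarrow> engel" where
  "engel_mult x y =
     x + y + (1/2) *\<^sub>R engel_bracket x y
       + (1/12) *\<^sub>R (engel_bracket x (engel_bracket x y) + engel_bracket y (engel_bracket y x))"

text \<open>The left-invariant vector field with value \<open>v\<close> at the identity, as a derivation:
  \<open>(Xf)(p) = d/dt f(p exp(tv))\<close> at \<open>t = 0\<close>, where \<open>exp(tv) = tv\<close>.\<close>

definition left_inv_field :: "engel \<Rightarrow> (engel \<Rightarrow> real) \<Rightarrow> engel \<Rightarrow> real" where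
  "left_inv_field v f p = deriv (\<lambda>t::real. f (engel_mult p (t *\<^sub>R v))) 0"

definition engel_X :: "4 \<Rightarrow> (engel \<Rightarrow> real) \<Rightarrow> engel \<Rightarrow> real" where
  "engel_X i = left_inv_field (axis i 1)"


section \<open>The model has the defining properties of the Engel group\<close>

lemma vector_4 [simp]:
  "(vector [a, b, c, d] :: 'a::zero^4) $ 1 = a"
  "(vector [a, b, c, d] :: 'a::zero^4) $ 2 = b"
  "(vector [a, b, c, d] :: 'a::zero^4) $ 3 = c"
  "(vector [a, b, c, d] :: 'a::zero^4) $ 4 = d"
  unfolding vector_def by auto

lemma bracket_nth [simp]:
  "engel_bracket x y $ 1 = 0" "engel_bracket x y $ 2 = 0"
  "engel_bracket x y $ 3 = x$1 * y$2 - x$2 * y$1"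
  "engel_bracket x y $ 4 = x$1 * y$3 - x$3 * y$1"
  by (simp_all add: engel_bracket_def)

lemma bilinear_bracket: "bilinear engel_bracket"
  by (auto simp: bilinear_def linear_iff vec_eq_iff forall_4 algebra_simps)

lemma bracket_self: "engel_bracket x x = 0"
  by (simp add: vec_eq_iff forall_4)

lemma bracket_jacobi:
  "engel_bracket x (engel_bracket y z) + engel_bracket y (engel_bracket z x)
     + engel_bracket z (engel_bracket x y) = 0"
  by (simp add: vec_eq_iff forall_4 algebra_simps)

lemma bracket_basis:
  "engel_bracket (axis 1 1) (axis 2 1) = axis 3 1"
  "engel_bracket (axis 1 1) (axis 3 1) = axis 4 1"
  "engel_bracket (axis 1 1) (axis 4 1) = 0"
  "engel_bracket (axis 2 1) (axis 3 1) = 0"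
  "engel_bracket (axis 2 1) (axis 4 1) = 0"
  "engel_bracket (axis 3 1) (axis 4 1) = 0"
  by (simp_all add: vec_eq_iff forall_4 axis_def)

lemma engel_mult_assoc: "engel_mult (engel_mult x y) z = engel_mult x (engel_mult y z)"
  by (simp add: engel_mult_def vec_eq_iff forall_4 field_simps)

lemma engel_mult_zero: "engel_mult 0 x = x" "engel_mult x 0 = x"
  by (simp_all add: engel_mult_def vec_eq_iff forall_4)

lemma engel_mult_minus: "engel_mult (- x) x = 0" "engel_mult x (- x) = 0"
  by (simp_all add: engel_mult_def vec_eq_iff forall_4)

lemma engel_mult_one_parameter: "engel_mult (s *\<^sub>R v) (t *\<^sub>R v) = (s + t) *\<^sub>R v"
  by (simp add: engel_mult_def vec_eq_iff forall_4 algebra_simps)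

lemma left_inv_field_translation:
  "left_inv_field v (\<lambda>x. f (engel_mult a x)) p = left_inv_field v f (engel_mult a p)"
  by (simp add: left_inv_field_def engel_mult_assoc)

text \<open>The bracket relations hold for the \<open>X\<^sub>i\<close> as differential operators on smooth functions.\<close>

lemma left_inv_field_eq:
  assumes "f differentiable (at p)"
  shows "left_inv_field v f p =
    frechet_derivative f (at p)
      (v + (1/2) *\<^sub>R engel_bracket p v + (1/12) *\<^sub>R engel_bracket p (engel_bracket p v))"
proof -
  let ?w = "v + (1/2) *\<^sub>R engel_bracket p v + (1/12) *\<^sub>R engel_bracket p (engel_bracket p v)"
  let ?u = "(1/12) *\<^sub>R engel_bracket v (engel_bracket v p)"
  have eq: "engel_mult p (t *\<^sub>R v) = p + t *\<^sub>R ?w + t^2 *\<^sub>R ?u" for t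
    by (simp add: engel_mult_def vec_eq_iff forall_4 algebra_simps power2_eq_square)
  have 1: "((\<lambda>t. p + t *\<^sub>R ?w + t^2 *\<^sub>R ?u) has_derivative (\<lambda>t. t *\<^sub>R ?w)) (at 0)"
    by (auto intro!: derivative_eq_intros)
  have 2: "(f has_derivative frechet_derivative f (at p)) (at (p + 0 *\<^sub>R ?w + 0^2 *\<^sub>R ?u))"
    using assms by (simp flip: frechet_derivative_works)
  have "((\<lambda>t. f (p + t *\<^sub>R ?w + t^2 *\<^sub>R ?u)) has_derivative
      (\<lambda>t. frechet_derivative f (at p) (t *\<^sub>R ?w))) (at 0)"
    using has_derivative_compose[OF 1 2] .
  moreover have "frechet_derivative f (at p) (t *\<^sub>R ?w) = frechet_derivative f (at p) ?w * t" for t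
    using linear_frechet_derivative[OF assms] by (simp add: linear_scale)
  ultimately have "((\<lambda>t. f (p + t *\<^sub>R ?w + t^2 *\<^sub>R ?u)) has_real_derivative
      frechet_derivative f (at p) ?w) (at 0)"
    by (simp add: has_field_derivative_def)
  then show ?thesis
    unfolding left_inv_field_def eq by (rule DERIV_imp_deriv)
qed

lemma directional_DERIV:
  assumes "\<And>x. f differentiable (at x)"
  shows "((\<lambda>t::real. f (x + t *\<^sub>R v)) has_real_derivative
           frechet_derivative f (at (x + t *\<^sub>R v)) v) (at t)"
proof -
  have 1: "((\<lambda>t. x + t *\<^sub>R v) has_derivative (\<lambda>t. t *\<^sub>R v)) (at t)"
    by (auto intro!: derivative_eq_intros)
  have 2: "(f has_derivative frechet_derivative f (at (x + t *\<^sub>R v))) (at (x + t *\<^sub>R v))"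
    using assms frechet_derivative_works by blast
  have "((\<lambda>t. f (x + t *\<^sub>R v)) has_derivative
      (\<lambda>s. frechet_derivative f (at (x + t *\<^sub>R v)) (s *\<^sub>R v))) (at t)"
    using has_derivative_compose[OF 1 2] .
  moreover have "frechet_derivative f (at (x + t *\<^sub>R v)) (s *\<^sub>R v) =
      frechet_derivative f (at (x + t *\<^sub>R v)) v * s" for s
    using linear_frechet_derivative[OF assms] by (simp add: linear_scale)
  ultimately show ?thesis
    by (simp add: has_field_derivative_def)
qed

lemma second_difference:
  fixes f :: "'a::euclidean_space \<Rightarrow> real"
  assumes f: "\<And>x. f differentiable (at x)"
    and fu: "\<And>x. (\<lambda>x. frechet_derivative f (at x) u) differentiable (at x)"
    and "h > 0"
  shows "\<exists>s t. 0 < s \<and> s < h \<and> 0 < t \<and> t < h \<and>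
    (f (x + (h *\<^sub>R u + h *\<^sub>R v)) + f x - (f (x + h *\<^sub>R u) + f (x + h *\<^sub>R v))) / (h * h) =
    frechet_derivative (\<lambda>x. frechet_derivative f (at x) u) (at (x + s *\<^sub>R u + t *\<^sub>R v)) v"
proof -
  let ?D = "\<lambda>x. frechet_derivative f (at x) u"
  have d: "((\<lambda>s. f (x + h *\<^sub>R v + s *\<^sub>R u) - f (x + s *\<^sub>R u)) has_real_derivative
      ?D (x + h *\<^sub>R v + s *\<^sub>R u) - ?D (x + s *\<^sub>R u)) (at s)" for s
    by (intro DERIV_diff directional_DERIV f)
  obtain s where s: "0 < s" "s < h"
    "(f (x + h *\<^sub>R v + h *\<^sub>R u) - f (x + h *\<^sub>R u)) - (f (x + h *\<^sub>R v + 0 *\<^sub>R u) - f (x + 0 *\<^sub>R u))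
      = (h - 0) * (?D (x + h *\<^sub>R v + s *\<^sub>R u) - ?D (x + s *\<^sub>R u))"
    using MVT2[OF \<open>h > 0\<close> d] by blast
  have d': "((\<lambda>t. ?D (x + s *\<^sub>R u + t *\<^sub>R v)) has_real_derivative
      frechet_derivative ?D (at (x + s *\<^sub>R u + t *\<^sub>R v)) v) (at t)" for t
    by (rule directional_DERIV[OF fu])
  obtain t where t: "0 < t" "t < h"
    "?D (x + s *\<^sub>R u + h *\<^sub>R v) - ?D (x + s *\<^sub>R u + 0 *\<^sub>R v)
      = (h - 0) * frechet_derivative ?D (at (x + s *\<^sub>R u + t *\<^sub>R v)) v"
    using MVT2[OF \<open>h > 0\<close> d'] by blast
  have "f (x + (h *\<^sub>R u + h *\<^sub>R v)) + f x - (f (x + h *\<^sub>R u) + f (x + h *\<^sub>R v)) =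
    h * (?D (x + s *\<^sub>R u + h *\<^sub>R v) - ?D (x + s *\<^sub>R u + 0 *\<^sub>R v))"
    using s(3) by (simp add: algebra_simps)
  also have "\<dots> / (h * h) = frechet_derivative ?D (at (x + s *\<^sub>R u + t *\<^sub>R v)) v"
    unfolding t(3) using \<open>h > 0\<close> by simp
  finally show ?thesis
    using s t by blast
qed

lemma directional_derivatives_commute:
  fixes f :: "'a::euclidean_space \<Rightarrow> real"
  assumes "C_k 2 f"
  shows "frechet_derivative (\<lambda>x. frechet_derivative f (at x) u) (at x) v =
         frechet_derivative (\<lambda>x. frechet_derivative f (at x) v) (at x) u"
proof -
  define A where "A u v y = frechet_derivative (\<lambda>x. frechet_derivative f (at x) u) (at y) v" for u v y
  define Q where "Q u v h =
    (f (x + (h *\<^sub>R u + h *\<^sub>R v)) + f x - (f (x + h *\<^sub>R u) + f (x + h *\<^sub>R v))) / (h * h)" for u v h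
  define h where "h n = inverse (real (Suc n))" for n
  have h: "h n > 0" "h \<longlonglongrightarrow> 0" for n
    using LIMSEQ_inverse_real_of_nat by (simp_all add: h_def[abs_def])
  have f: "\<And>x. f differentiable (at x)"
    and f': "\<And>u x. (\<lambda>x. frechet_derivative f (at x) u) differentiable (at x)"
    and cont: "\<And>u v. continuous_on UNIV (A u v)"
    using assms by (auto simp: A_def numeral_2_eq_2 fun_eq_iff)
  have lim: "(\<lambda>n. Q u v (h n)) \<longlonglongrightarrow> A u v x" for u v
  proof -
    have "\<exists>s t. 0 < s \<and> s < h n \<and> 0 < t \<and> t < h n \<and> Q u v (h n) = A u v (x + s *\<^sub>R u + t *\<^sub>R v)" for n
      unfolding Q_def A_def by (rule second_difference[OF f f' h(1)])
    then obtain s t where st: "\<And>n. 0 < s n \<and> s n < h n \<and> 0 < t n \<and> t n < h n"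
      and Q: "\<And>n. Q u v (h n) = A u v (x + s n *\<^sub>R u + t n *\<^sub>R v)"
      by metis
    have s: "s \<longlonglongrightarrow> 0" and t: "t \<longlonglongrightarrow> 0"
      using st by (auto intro!: tendsto_sandwich[OF _ _ tendsto_const h(2)]
          always_eventually less_imp_le)
    have "(\<lambda>n. x + s n *\<^sub>R u + t n *\<^sub>R v) \<longlonglongrightarrow> x + 0 *\<^sub>R u + 0 *\<^sub>R v"
      by (intro tendsto_intros s t)
    moreover have "isCont (A u v) x"
      using cont by (simp add: continuous_on_eq_continuous_at)
    ultimately show ?thesis
      unfolding Q using isCont_tendsto_compose by fastforce
  qed
  have "Q u v = Q v u"
    by (simp add: Q_def fun_eq_iff add.commute)
  then have "A u v x = A v u x"
    using LIMSEQ_unique[OF lim[of u v]] lim[of v u] by simp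
  then show ?thesis
    by (simp add: A_def)
qed

lemma smooth_differentiable: "smooth f \<Longrightarrow> f differentiable (at x)"
  unfolding smooth_def by (metis C_k.simps(2))

lemma smooth_directional: "smooth f \<Longrightarrow> smooth (\<lambda>x. frechet_derivative f (at x) v)"
  unfolding smooth_def by (metis C_k.simps(2))

lemma engel_X_eq:
  assumes "f differentiable (at p)"
  defines "D \<equiv> \<lambda>i. frechet_derivative f (at p) (axis i 1)"
  shows "engel_X 1 f p = D 1 - p$2 / 2 * D 3 - (p$3 / 2 + p$1 * p$2 / 12) * D 4"
    and "engel_X 2 f p = D 2 + p$1 / 2 * D 3 + p$1 * p$1 / 12 * D 4"
    and "engel_X 3 f p = D 3 + p$1 / 2 * D 4"
    and "engel_X 4 f p = D 4"
proof -
  have lin: "linear (frechet_derivative f (at p))"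
    using assms(1) by (rule linear_frechet_derivative)
  have exp: "w = w$1 *\<^sub>R axis 1 1 + w$2 *\<^sub>R axis 2 1 + w$3 *\<^sub>R axis 3 1 + w$4 *\<^sub>R axis 4 1"
    for w :: engel
    by (simp add: vec_eq_iff forall_4 axis_def)
  have D: "frechet_derivative f (at p) w = w$1 * D 1 + w$2 * D 2 + w$3 * D 3 + w$4 * D 4" for w
    by (subst exp[of w]) (simp add: D_def linear_add[OF lin] linear_scale[OF lin])
  show "engel_X 1 f p = D 1 - p$2 / 2 * D 3 - (p$3 / 2 + p$1 * p$2 / 12) * D 4"
    "engel_X 2 f p = D 2 + p$1 / 2 * D 3 + p$1 * p$1 / 12 * D 4"
    "engel_X 3 f p = D 3 + p$1 / 2 * D 4"
    "engel_X 4 f p = D 4"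
    unfolding engel_X_def left_inv_field_eq[OF assms(1)] D
    by (simp_all add: axis_def algebra_simps)
qed

lemma engel_X_has_derivative:
  assumes "smooth f"
  defines "D \<equiv> \<lambda>i p. frechet_derivative f (at p) (axis i 1)"
  defines "DD \<equiv> \<lambda>i p. frechet_derivative (D i) (at p)"
  shows "(engel_X 1 f has_derivative (\<lambda>w. DD 1 p w - (w$2 / 2 * D 3 p + p$2 / 2 * DD 3 p w)
      - ((w$3 / 2 + (w$1 * p$2 + p$1 * w$2) / 12) * D 4 p + (p$3 / 2 + p$1 * p$2 / 12) * DD 4 p w)))
      (at p)"
    and "(engel_X 2 f has_derivative (\<lambda>w. DD 2 p w + (w$1 / 2 * D 3 p + p$1 / 2 * DD 3 p w)
      + (2 * p$1 * w$1 / 12 * D 4 p + p$1 * p$1 / 12 * DD 4 p w))) (at p)"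
    and "(engel_X 3 f has_derivative (\<lambda>w. DD 3 p w + (w$1 / 2 * D 4 p + p$1 / 2 * DD 4 p w))) (at p)"
    and "(engel_X 4 f has_derivative DD 4 p) (at p)"
proof -
  have d: "(D i has_derivative DD i p) (at p)" for i
    unfolding DD_def D_def frechet_derivative_works[symmetric]
    using assms(1) by (intro smooth_differentiable smooth_directional)
  have c: "((\<lambda>x::engel. x $ i) has_derivative (\<lambda>w. w $ i)) (at p)" for i
    by (rule bounded_linear_imp_has_derivative[OF bounded_linear_vec_nth])
  have X: "engel_X 1 f = (\<lambda>p. D 1 p - p$2 / 2 * D 3 p - (p$3 / 2 + p$1 * p$2 / 12) * D 4 p)"
    "engel_X 2 f = (\<lambda>p. D 2 p + p$1 / 2 * D 3 p + p$1 * p$1 / 12 * D 4 p)"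
    "engel_X 3 f = (\<lambda>p. D 3 p + p$1 / 2 * D 4 p)"
    "engel_X 4 f = D 4"
    using engel_X_eq[OF smooth_differentiable[OF assms(1)]] by (auto simp: D_def fun_eq_iff)
  show "(engel_X 1 f has_derivative (\<lambda>w. DD 1 p w - (w$2 / 2 * D 3 p + p$2 / 2 * DD 3 p w)
      - ((w$3 / 2 + (w$1 * p$2 + p$1 * w$2) / 12) * D 4 p + (p$3 / 2 + p$1 * p$2 / 12) * DD 4 p w)))
      (at p)"
    unfolding X by (rule derivative_eq_intros d c refl | simp)+ (simp add: fun_eq_iff field_simps)
  show "(engel_X 2 f has_derivative (\<lambda>w. DD 2 p w + (w$1 / 2 * D 3 p + p$1 / 2 * DD 3 p w)
      + (2 * p$1 * w$1 / 12 * D 4 p + p$1 * p$1 / 12 * DD 4 p w))) (at p)"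
    unfolding X by (rule derivative_eq_intros d c refl | simp)+ (simp add: fun_eq_iff field_simps)
  show "(engel_X 3 f has_derivative (\<lambda>w. DD 3 p w + (w$1 / 2 * D 4 p + p$1 / 2 * DD 4 p w))) (at p)"
    unfolding X by (rule derivative_eq_intros d c refl | simp)+ (simp add: fun_eq_iff field_simps)
  show "(engel_X 4 f has_derivative DD 4 p) (at p)"
    unfolding X by (rule d)
qed

lemma engel_X_commutators:
  assumes "smooth f"
  shows "engel_X 1 (engel_X 2 f) p - engel_X 2 (engel_X 1 f) p = engel_X 3 f p"
    and "engel_X 1 (engel_X 3 f) p - engel_X 3 (engel_X 1 f) p = engel_X 4 f p"
    and "engel_X 1 (engel_X 4 f) p = engel_X 4 (engel_X 1 f) p"
    and "engel_X 2 (engel_X 3 f) p = engel_X 3 (engel_X 2 f) p"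
    and "engel_X 2 (engel_X 4 f) p = engel_X 4 (engel_X 2 f) p"
    and "engel_X 3 (engel_X 4 f) p = engel_X 4 (engel_X 3 f) p"
proof -
  define D where "D i p = frechet_derivative f (at p) (axis i 1)" for i p
  define DD where "DD i j = frechet_derivative (D i) (at p) (axis j 1)" for i j
  have D_abs: "D i = (\<lambda>p. frechet_derivative f (at p) (axis i 1))" for i
    by (simp add: D_def fun_eq_iff)
  have sym: "DD i j = DD j i" for i j
    unfolding DD_def D_abs
    by (rule directional_derivatives_commute) (use assms in \<open>simp add: smooth_def\<close>)
  note hd = engel_X_has_derivative[OF assms, of p, folded D_abs]
  note fd = hd[THEN frechet_derivative_at, symmetric]
  have diff: "engel_X 1 f differentiable (at p)" "engel_X 2 f differentiable (at p)"
    "engel_X 3 f differentiable (at p)" "engel_X 4 f differentiable (at p)"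
    using hd by (auto simp: differentiable_def)
  note eqs = engel_X_eq[OF smooth_differentiable[OF assms], of p, folded D_def]
    diff[THEN engel_X_eq(1)] diff[THEN engel_X_eq(2)]
    diff[THEN engel_X_eq(3)] diff[THEN engel_X_eq(4)]
  have ax: "(axis i 1 :: engel) $ j = (if i = j then 1 else 0)" for i j
    by (simp add: axis_def)
  show "engel_X 1 (engel_X 2 f) p - engel_X 2 (engel_X 1 f) p = engel_X 3 f p"
    "engel_X 1 (engel_X 3 f) p - engel_X 3 (engel_X 1 f) p = engel_X 4 f p"
    "engel_X 1 (engel_X 4 f) p = engel_X 4 (engel_X 1 f) p"
    "engel_X 2 (engel_X 3 f) p = engel_X 3 (engel_X 2 f) p"
    "engel_X 2 (engel_X 4 f) p = engel_X 4 (engel_X 2 f) p"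
    "engel_X 3 (engel_X 4 f) p = engel_X 4 (engel_X 3 f) p"
    unfolding eqs fd DD_def[symmetric] ax
      sym[of 2 1] sym[of 3 1] sym[of 4 1] sym[of 3 2] sym[of 4 2] sym[of 4 3]
    by (simp_all add: D_def field_simps)
qed

end

theory Submission
  imports Defs
begin

text \<open>The inclusion from left to right is the identity \<open>X\<^sub>1 X\<^sub>2\<^sup>2 f = X\<^sub>2 X\<^sub>1 X\<^sub>2 f + X\<^sub>2 X\<^sub>3 f\<close>.
  Conversely, \<open>X\<^sub>2\<close> is onto by integration along its flow, so some \<open>f\<^sub>0\<close> has \<open>- X\<^sub>2\<^sup>2 f\<^sub>0 = h\<close>.
  By the first inclusion the defect \<open>(- X\<^sub>3 f\<^sub>0 - X\<^sub>1 X\<^sub>2 f\<^sub>0) - g\<close> is then annihilated by \<open>X\<^sub>2\<close>.  Since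
  \<open>X\<^sub>2\<close> and \<open>X\<^sub>3\<close> commute, integrating the defect along the flow of \<open>X\<^sub>3\<close>, starting from a
  hypersurface invariant under the flow of \<open>X\<^sub>2\<close>, gives \<open>a\<close> with \<open>X\<^sub>2 a = 0\<close> and \<open>X\<^sub>3 a\<close> equal to the
  defect, and \<open>f = f\<^sub>0 + a\<close> works.\<close>

section \<open>Closure properties of smooth functions\<close>

lemma C_k_Suc_imp: "C_k (Suc k) f \<Longrightarrow> C_k k f"
proof (induction k arbitrary: f)
  case 0
  then show ?case
    by (auto intro!: continuous_at_imp_continuous_on differentiable_imp_continuous_within)
next
  case (Suc k)
  show ?case
    unfolding C_k.simps(2)[of k]
    using Suc.prems Suc.IH by (metis C_k.simps(2))
qed

text \<open>Since the Frechet derivative is unique, any explicit formula for it may replace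
  \<open>frechet_derivative\<close>; the inductions below take theirs from the calculus
  rules.\<close>

lemma C_k_SucI:
  assumes "\<And>x. (f has_derivative f' x) (at x)" "\<And>v. C_k k (\<lambda>x. f' x v)"
  shows "C_k (Suc k) f"
proof -
  have "frechet_derivative f (at x) = f' x" for x
    using frechet_derivative_at[OF assms(1)] by simp
  then show ?thesis
    using assms by (auto simp: differentiable_def)
qed

lemma C_k_Suc_has_derivative:
  "C_k (Suc k) f \<Longrightarrow> (f has_derivative frechet_derivative f (at x)) (at x)"
  using frechet_derivative_works by auto

lemma C_k_const: "C_k k (\<lambda>x. c)"
proof (induction k arbitrary: c)
  case (Suc k)
  show ?case
    by (rule C_k_SucI[where f' = "\<lambda>_ _. 0"]) (auto simp: Suc)
qed auto

lemma C_k_linear: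
  fixes f :: "'a::euclidean_space \<Rightarrow> real"
  assumes "bounded_linear f"
  shows "C_k k f"
proof (cases k)
  case 0
  then show ?thesis
    using assms by (simp add: linear_continuous_on)
next
  case (Suc n)
  show ?thesis
    unfolding Suc
    by (rule C_k_SucI[where f' = "\<lambda>_. f"])
      (auto simp: C_k_const intro: bounded_linear_imp_has_derivative assms)
qed

lemma C_k_add: "C_k k f \<Longrightarrow> C_k k g \<Longrightarrow> C_k k (\<lambda>x. f x + g x)"
proof (induction k arbitrary: f g)
  case (Suc k)
  show ?case
    by (rule C_k_SucI[OF has_derivative_add[OF Suc.prems[THEN C_k_Suc_has_derivative]]])
      (use Suc in auto)
qed (auto intro: continuous_on_add)

lemma C_k_mult: "C_k k f \<Longrightarrow> C_k k g \<Longrightarrow> C_k k (\<lambda>x. f x * g x)"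
proof (induction k arbitrary: f g)
  case (Suc k)
  \<comment> \<open>The product rule leaves one factor undifferentiated, so the induction hypothesis
    is also applied to \<open>f\<close> and \<open>g\<close> themselves.\<close>
  have "C_k k f" "C_k k g"
    using Suc.prems by (auto intro: C_k_Suc_imp)
  then show ?case
    by (intro C_k_SucI[OF has_derivative_mult[OF Suc.prems[THEN C_k_Suc_has_derivative]]]
        C_k_add Suc.IH) (use Suc.prems in auto)
qed (auto intro: continuous_on_mult)

lemma C_k_sum: "(\<And>i. i \<in> I \<Longrightarrow> C_k k (f i)) \<Longrightarrow> C_k k (\<lambda>x. \<Sum>i\<in>I. f i x)"
  by (induction I rule: infinite_finite_induct) (auto simp: C_k_const C_k_add)

text \<open>The chain rule writes each directional derivative as a finite sum of smooth functions
  times partial derivatives of \<open>f\<close> along \<open>\<phi>\<close>. These partial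
  derivatives are one class lower, so the induction runs over all \<open>f\<close>.\<close>

lemma C_k_compose:
  fixes \<phi> :: "'a::euclidean_space \<Rightarrow> 'b::euclidean_space"
  assumes \<phi>: "\<And>b. b \<in> Basis \<Longrightarrow> smooth (\<lambda>x. \<phi> x \<bullet> b)"
  shows "C_k k f \<Longrightarrow> C_k k (\<lambda>x. f (\<phi> x))"
proof (induction k arbitrary: f)
  case 0
  have "continuous_on UNIV \<phi>"
    using \<phi> by (intro continuous_on_componentwise[THEN iffD2])
      (metis smooth_def C_k.simps(1))
  then show ?case
    using 0 continuous_on_compose2[of UNIV f UNIV \<phi>] by simp
next
  case (Suc k)
  define \<phi>' where "\<phi>' x v = (\<Sum>b\<in>Basis. frechet_derivative (\<lambda>x. \<phi> x \<bullet> b) (at x) v *\<^sub>R b)" for x v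
  have "((\<lambda>x. \<phi> x \<bullet> b) has_derivative (\<lambda>v. \<phi>' x v \<bullet> b)) (at x)" if "b \<in> Basis" for x b
    using smooth_differentiable[OF \<phi>[OF that], of x] that
    by (simp add: \<phi>'_def frechet_derivative_works)
  then have d\<phi>: "(\<phi> has_derivative \<phi>' x) (at x)" for x
    by (subst has_derivative_componentwise_within) auto
  have "((\<lambda>x. f (\<phi> x)) has_derivative (\<lambda>v. frechet_derivative f (at (\<phi> x)) (\<phi>' x v))) (at x)" for x
    by (rule has_derivative_compose[OF d\<phi> C_k_Suc_has_derivative[OF Suc.prems]])
  moreover have "frechet_derivative f (at (\<phi> x)) (\<phi>' x v) =
      (\<Sum>b\<in>Basis. frechet_derivative (\<lambda>x. \<phi> x \<bullet> b) (at x) v * frechet_derivative f (at (\<phi> x)) b)"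
    for x v
  proof -
    have "linear (frechet_derivative f (at (\<phi> x)))"
      using Suc.prems by (auto intro: linear_frechet_derivative)
    then show ?thesis
      by (simp add: \<phi>'_def linear_sum linear_scale)
  qed
  ultimately have d: "((\<lambda>x. f (\<phi> x)) has_derivative
      (\<lambda>v. \<Sum>b\<in>Basis. frechet_derivative (\<lambda>x. \<phi> x \<bullet> b) (at x) v * frechet_derivative f (at (\<phi> x)) b))
      (at x)" for x
    by simp
  show ?case
  proof (rule C_k_SucI[OF d])
    fix v
    have "C_k k (\<lambda>x. frechet_derivative (\<lambda>x. \<phi> x \<bullet> b) (at x) v)" if "b \<in> Basis" for b
      using smooth_directional[OF \<phi>[OF that]] by (simp add: smooth_def)
    moreover have "C_k k (\<lambda>x. frechet_derivative f (at (\<phi> x)) b)" for b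
      using Suc by auto
    ultimately show "C_k k (\<lambda>x. \<Sum>b\<in>Basis. frechet_derivative (\<lambda>x. \<phi> x \<bullet> b) (at x) v *
        frechet_derivative f (at (\<phi> x)) b)"
      by (intro C_k_sum C_k_mult)
  qed
qed

text \<open>Differentiating under the integral sign in direction \<open>v\<close> gives another
  integral of the same kind, whose integrand is the derivative of \<open>f\<close> in direction
  \<open>(v, 0)\<close>.\<close>

lemma C_k_integral:
  fixes f :: "'a::euclidean_space \<times> real \<Rightarrow> real"
  shows "C_k k f \<Longrightarrow> C_k k (\<lambda>x. integral {a..b} (\<lambda>t. f (x, t)))"
proof (induction k arbitrary: f)
  case 0
  then have "continuous_on (UNIV \<times> cbox a b) (\<lambda>(x, t). f (x, t))"
    by (auto intro: continuous_on_subset)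
  from integral_continuous_on_param[OF this] show ?case
    by simp
next
  case (Suc k)
  \<comment> \<open>The Leibniz rule asks for a continuous operator-valued derivative; continuity of
    \<open>f'\<close> is then checked on basis vectors.\<close>
  define f' where "f' x t = Blinfun (\<lambda>v. frechet_derivative f (at (x, t)) (v, 0))" for x t
  have bl: "bounded_linear (\<lambda>v. frechet_derivative f (at (x, t)) (v, 0))" for x t
    by (rule bounded_linear_compose[OF
          has_derivative_bounded_linear[OF C_k_Suc_has_derivative[OF Suc.prems]]])
      (intro bounded_linear_intros)
  then have f': "blinfun_apply (f' x t) v = frechet_derivative f (at (x, t)) (v, 0)" for x t v
    by (simp add: f'_def bounded_linear_Blinfun_apply)
  have cont: "continuous_on UNIV f"
    using C_k_Suc_has_derivative[OF Suc.prems] has_derivative_continuous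
    by (blast intro: continuous_at_imp_continuous_on)
  have cont': "continuous_on UNIV (\<lambda>p. frechet_derivative f (at p) w)" for w
  proof -
    have "C_k k (\<lambda>p. frechet_derivative f (at p) w)"
      using Suc.prems C_k.simps(2) by blast
    then show ?thesis
    proof (cases k)
      case (Suc n)
      with \<open>C_k k _\<close> C_k_Suc_has_derivative has_derivative_continuous show ?thesis
        by (blast intro: continuous_at_imp_continuous_on)
    qed auto
  qed
  have cf': "continuous_on (UNIV \<times> cbox a b) (\<lambda>(x, t). f' x t)"
  proof (rule continuous_on_blinfun_componentwise)
    fix i :: 'a
    show "continuous_on (UNIV \<times> cbox a b) (\<lambda>p. blinfun_apply (case p of (x, t) \<Rightarrow> f' x t) i)"
      using continuous_on_subset[OF cont'[of "(i, 0)"]] by (simp add: case_prod_unfold f')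
  qed
  have ct: "continuous_on {a..b} (\<lambda>t. f (x, t))" for x
    by (rule continuous_on_compose2[OF cont]) (auto intro!: continuous_intros)
  have ct': "continuous_on {a..b} (f' x)" for x
    by (rule continuous_on_compose2[OF cf', of _ "\<lambda>t. (x, t)", simplified])
      (auto intro!: continuous_intros)
  have "((\<lambda>x. f (x, t)) has_derivative blinfun_apply (f' x t)) (at x)" for x t
  proof -
    have 1: "((\<lambda>x. (x, t)) has_derivative (\<lambda>v. (v, 0))) (at x)"
      by (auto intro!: derivative_eq_intros)
    show ?thesis
      using has_derivative_compose[OF 1 C_k_Suc_has_derivative[OF Suc.prems]]
      by (simp add: f'[abs_def])
  qed
  then have d: "((\<lambda>x. integral (cbox a b) (\<lambda>t. f (x, t))) has_derivative
      blinfun_apply (integral (cbox a b) (f' x))) (at x)" for x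
    using leibniz_rule[of UNIV a b "\<lambda>x t. f (x, t)" f' x] cf' ct
    by (auto intro: integrable_continuous_interval)
  have *: "blinfun_apply (integral {a..b} (f' x)) v =
      integral {a..b} (\<lambda>t. frechet_derivative f (at (x, t)) (v, 0))" for x v
    using blinfun_apply_integral[OF integrable_continuous_interval[OF ct'], of x v]
    by (simp add: f')
  show ?case
  proof (rule C_k_SucI[OF d[simplified]])
    fix v
    have "C_k k (\<lambda>p. frechet_derivative f (at p) (v, 0))"
      using Suc.prems C_k.simps(2) by blast
    from Suc.IH[OF this] show "C_k k (\<lambda>x. blinfun_apply (integral {a..b} (f' x)) v)"
      by (simp add: *)
  qed
qed

lemma smooth_const: "smooth (\<lambda>x. c)"
  and smooth_add: "smooth f \<Longrightarrow> smooth g \<Longrightarrow> smooth (\<lambda>x. f x + g x)"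
  and smooth_mult: "smooth f \<Longrightarrow> smooth g \<Longrightarrow> smooth (\<lambda>x. f x * g x)"
  by (auto simp: smooth_def C_k_const C_k_add C_k_mult)

lemma smooth_minus: "smooth f \<Longrightarrow> smooth (\<lambda>x. - f x)"
  using smooth_mult[OF smooth_const[of "-1"]] by simp

lemma smooth_diff: "smooth f \<Longrightarrow> smooth g \<Longrightarrow> smooth (\<lambda>x. f x - g x)"
  using smooth_add[OF _ smooth_minus] by fastforce

lemma smooth_linear:
  fixes f :: "'a::euclidean_space \<Rightarrow> real"
  shows "bounded_linear f \<Longrightarrow> smooth f"
  by (simp add: smooth_def C_k_linear)

lemma smooth_nth:
  fixes f :: "'a::euclidean_space \<Rightarrow> real^'n"
  shows "bounded_linear f \<Longrightarrow> smooth (\<lambda>x. f x $ i)"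
  by (intro smooth_linear bounded_linear_compose[OF bounded_linear_vec_nth])

lemmas smooth_intros = smooth_const smooth_add smooth_mult smooth_minus smooth_diff

lemma smooth_compose_vec:
  fixes \<phi> :: "'a::euclidean_space \<Rightarrow> real^'n"
  assumes "smooth f" "\<And>i. smooth (\<lambda>x. \<phi> x $ i)"
  shows "smooth (\<lambda>x. f (\<phi> x))"
proof -
  have "smooth (\<lambda>x. \<phi> x \<bullet> b)" if "b \<in> Basis" for b
    using that assms(2) by (auto simp: Basis_vec_def inner_axis)
  then show ?thesis
    using assms(1) C_k_compose unfolding smooth_def by blast
qed

section \<open>Left-invariant fields\<close>

text \<open>The components of a product in the group are polynomials in the components of the two
  factors.\<close>

lemma smooth_translate:
  fixes \<phi> :: "'a::euclidean_space \<Rightarrow> engel"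
  assumes "smooth f" "\<And>i. smooth (\<lambda>x. \<phi> x $ i)" "smooth c"
  shows "smooth (\<lambda>x. f (engel_mult (\<phi> x) (c x *\<^sub>R v)))"
proof (rule smooth_compose_vec[OF assms(1)])
  have "\<forall>i::4. smooth (\<lambda>x. engel_mult (\<phi> x) (c x *\<^sub>R v) $ i)"
    unfolding forall_4 engel_mult_def vector_add_component vector_scaleR_component bracket_nth
      real_scaleR_def
    by (intro conjI smooth_intros assms(2-))
  then show "smooth (\<lambda>x. engel_mult (\<phi> x) (c x *\<^sub>R v) $ i)" for i
    by blast
qed

text \<open>By the one-parameter law, moving on from time \<open>t\<close> is moving from time 0 at
  the base point \<open>engel_mult p (t *\<^sub>R v)\<close>, so the derivative at 0 determines all
  others.\<close>

lemma left_inv_field_DERIV: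
  assumes "smooth f"
  shows "((\<lambda>t. f (engel_mult p (t *\<^sub>R v))) has_real_derivative
    left_inv_field v f (engel_mult p (t *\<^sub>R v))) (at t)"
proof -
  have "smooth (\<lambda>s::real. f (engel_mult q (s *\<^sub>R v)))" for q
    by (rule smooth_translate[OF assms]) (auto intro: smooth_const smooth_linear)
  \<comment> \<open>\<open>deriv\<close> carries information only once differentiability at 0 is
    known.\<close>
  then have "(\<lambda>s::real. f (engel_mult q (s *\<^sub>R v))) field_differentiable (at 0)" for q
    using smooth_differentiable
    by (metis real_differentiable_def field_differentiable_def)
  then have "((\<lambda>s. f (engel_mult q (s *\<^sub>R v))) has_real_derivative left_inv_field v f q) (at 0)" for q
    unfolding left_inv_field_def using DERIV_deriv_iff_field_differentiable by blast
  from this[of "engel_mult p (t *\<^sub>R v)"] show ?thesis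
    using DERIV_shift[of "\<lambda>t. f (engel_mult p (t *\<^sub>R v))" _ 0 t]
    by (simp add: engel_mult_assoc engel_mult_one_parameter add.commute)
qed

lemma left_inv_field_DERIV_0:
  "smooth f \<Longrightarrow> ((\<lambda>t. f (engel_mult p (t *\<^sub>R v))) has_real_derivative left_inv_field v f p) (at 0)"
  using left_inv_field_DERIV[of f p v 0] by (simp add: engel_mult_zero)

lemma engel_X_add:
  "smooth f \<Longrightarrow> smooth g \<Longrightarrow> engel_X i (\<lambda>p. f p + g p) p = engel_X i f p + engel_X i g p"
  unfolding engel_X_def
  by (subst left_inv_field_def) (intro DERIV_imp_deriv DERIV_add left_inv_field_DERIV_0)

lemma engel_X_minus: "smooth f \<Longrightarrow> engel_X i (\<lambda>p. - f p) p = - engel_X i f p"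
  unfolding engel_X_def
  by (subst left_inv_field_def) (intro DERIV_imp_deriv DERIV_minus left_inv_field_DERIV_0)

text \<open>In coordinates each field is a combination of partial derivatives with polynomial
  coefficients.\<close>

lemma smooth_engel_X:
  assumes "smooth f"
  shows "smooth (engel_X i f)"
proof -
  have eq: "engel_X i f = (\<lambda>p. engel_X i f p)" for i
    by simp
  have div: "x / c = x * inverse c" for x c :: real
    by (simp add: field_simps)
  note eqs = engel_X_eq[OF smooth_differentiable[OF assms]]
  have "\<forall>i::4. smooth (engel_X i f)"
    unfolding forall_4
    by (subst (1 2 3 4) eq, unfold eqs div)
      (intro conjI smooth_intros smooth_directional assms smooth_nth bounded_linear_ident)
  then show ?thesis
    by blast
qed

lemma left_inv_field_eq_0_imp_invariant:
  assumes "smooth f" "\<And>p. left_inv_field v f p = 0"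
  shows "f (engel_mult p (t *\<^sub>R v)) = f p"
proof -
  have "\<forall>t. ((\<lambda>t. f (engel_mult p (t *\<^sub>R v))) has_real_derivative 0) (at t)"
    using left_inv_field_DERIV[OF assms(1), of p v] by (simp add: assms(2))
  from DERIV_isconst_all[OF this, of t 0] show ?thesis
    by (simp add: engel_mult_zero)
qed

text \<open>If \<open>q\<close> increases at unit speed along the flow of \<open>v\<close>, this is the integral of \<open>g\<close> along the
  flow line of \<open>v\<close> from the hypersurface \<open>q = 0\<close> to \<open>p\<close>, rescaled to the unit interval so that
  it is visibly smooth in \<open>p\<close>.\<close>

definition flow_integral :: "engel \<Rightarrow> (engel \<Rightarrow> real) \<Rightarrow> (engel \<Rightarrow> real) \<Rightarrow> engel \<Rightarrow> real" where
  "flow_integral v q g p =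
     q p * integral {0..1} (\<lambda>\<tau>. g (engel_mult p (((\<tau> - 1) * q p) *\<^sub>R v)))"

text \<open>The limits 0 and 1 are fixed and the integrand is jointly smooth on
  \<open>engel \<times> real\<close>, so \<open>C_k_integral\<close> applies.\<close>

lemma smooth_flow_integral:
  assumes "smooth q" "smooth g"
  shows "smooth (flow_integral v q g)"
proof -
  have q: "smooth (\<lambda>z::engel \<times> real. q (fst z))"
    by (rule smooth_compose_vec[OF assms(1)]) (intro smooth_nth bounded_linear_fst)
  have "smooth (\<lambda>z::engel \<times> real. g (engel_mult (fst z) (((snd z - 1) * q (fst z)) *\<^sub>R v)))"
    by (rule smooth_translate[OF assms(2)])
      (intro q smooth_nth smooth_intros bounded_linear_fst smooth_linear[OF bounded_linear_snd])+
  then have "smooth (\<lambda>p. integral {0..1} (\<lambda>\<tau>. g (engel_mult p (((\<tau> - 1) * q p) *\<^sub>R v))))"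
    unfolding smooth_def using C_k_integral by fastforce
  then show ?thesis
    unfolding flow_integral_def[abs_def] by (intro smooth_mult assms)
qed

lemma left_inv_field_flow_integral:
  assumes g: "smooth g" and q: "\<And>p t. q (engel_mult p (t *\<^sub>R v)) = q p + t"
  shows "left_inv_field v (flow_integral v q g) p = g p"
proof -
  \<comment> \<open>\<open>H s\<close> is the value of \<open>g\<close> at the point of the flow
    line through \<open>p\<close> where \<open>q\<close> equals \<open>s\<close>.\<close>
  define H where "H s = g (engel_mult p ((s - q p) *\<^sub>R v))" for s
  have "smooth H"
    unfolding H_def
    by (rule smooth_translate[OF g])
      (intro smooth_intros smooth_linear[OF bounded_linear_ident])+
  then have "\<exists>A. \<forall>s. -\<infinity> < ereal s \<longrightarrow> ereal s < \<infinity> \<longrightarrow> (A has_vector_derivative H s) (at s)"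
    by (intro einterval_antiderivative)
      (auto intro: smooth_differentiable differentiable_imp_continuous_within)
  then obtain A where A: "\<And>s. (A has_real_derivative H s) (at s)"
    by (auto simp: has_real_derivative_iff_has_vector_derivative)
  have "flow_integral v q g (engel_mult p (t *\<^sub>R v)) = A (q p + t) - A 0" for t
  proof -
    let ?c = "q p + t"
    \<comment> \<open>Pulling the antiderivative back to the unit interval treats all signs of
      \<open>?c\<close> at once, including \<open>?c = 0\<close>.\<close>
    have "((\<lambda>\<tau>. A (\<tau> * ?c)) has_real_derivative H (\<tau> * ?c) * ?c) (at \<tau> within {0..1})" for \<tau>
      by (rule DERIV_chain2[OF A]) (auto intro!: derivative_eq_intros)
    then have "((\<lambda>\<tau>. H (\<tau> * ?c) * ?c) has_integral A (1 * ?c) - A (0 * ?c)) {0..1}"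
      by (intro fundamental_theorem_of_calculus)
        (auto simp: has_real_derivative_iff_has_vector_derivative)
    then have "integral {0..1} (\<lambda>\<tau>. H (\<tau> * ?c)) * ?c = A ?c - A 0"
      by (simp add: integral_unique flip: integral_mult_left)
    \<comment> \<open>The two successive flow times, \<open>t\<close> and then that of the
      integrand, add up to the time used in \<open>H (\<tau> * ?c)\<close>.\<close>
    moreover have "t + (\<tau> - 1) * ?c = \<tau> * ?c - q p" for \<tau>
      by (simp add: algebra_simps)
    ultimately show ?thesis
      by (simp add: flow_integral_def q engel_mult_assoc engel_mult_one_parameter H_def
          mult.commute)
  qed
  moreover have "((\<lambda>t. A (q p + t) - A 0) has_real_derivative H (q p)) (at 0)"
    using DERIV_shift[of A "H (q p)" 0 "q p"] A[of "q p"]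
    by (auto intro!: derivative_eq_intros simp: add.commute)
  ultimately show ?thesis
    unfolding left_inv_field_def by (simp add: DERIV_imp_deriv H_def engel_mult_zero)
qed

text \<open>With vanishing bracket the two flows commute, so the flow of \<open>u\<close> carries
  flow lines of \<open>v\<close> to flow lines of \<open>v\<close>. As it preserves \<open>q\<close>
  and \<open>g\<close>, the flow integral is constant along it.\<close>

lemma left_inv_field_flow_integral_commuting:
  assumes "engel_bracket u v = 0"
    and q: "\<And>p t. q (engel_mult p (t *\<^sub>R u)) = q p"
    and g: "\<And>p t. g (engel_mult p (t *\<^sub>R u)) = g p"
  shows "left_inv_field u (flow_integral v q g) p = 0"
proof -
  have "engel_bracket (t *\<^sub>R u) (s *\<^sub>R v) = 0" "engel_bracket (s *\<^sub>R v) (t *\<^sub>R u) = 0" for s t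
    using assms(1) by (auto simp: vec_eq_iff forall_4 algebra_simps)
  then have comm: "engel_mult (t *\<^sub>R u) (s *\<^sub>R v) = engel_mult (s *\<^sub>R v) (t *\<^sub>R u)" for s t
    by (simp add: engel_mult_def add.commute)
  have "flow_integral v q g (engel_mult p (t *\<^sub>R u)) = flow_integral v q g p" for t
    \<comment> \<open>Commuting moves \<open>t *\<^sub>R u\<close> to the far right, where the
      invariance of \<open>g\<close> absorbs it.\<close>
    by (simp add: flow_integral_def q engel_mult_assoc comm) (simp add: g flip: engel_mult_assoc)
  then show ?thesis
    by (simp add: left_inv_field_def)
qed

section \<open>The second-order system\<close>

text \<open>Exchanging the outer pair in X_1 X_2 (X_2 f) costs X_3 X_2 f, and this equals X_2 X_3
  f.\<close>

lemma engel_system_compatible: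
  assumes f: "smooth f"
  shows "engel_X 2 (\<lambda>p. - engel_X 3 f p - engel_X 1 (engel_X 2 f) p) p =
    engel_X 1 (\<lambda>p. - engel_X 2 (engel_X 2 f) p) p"
proof -
  note s = smooth_engel_X smooth_minus f
  \<comment> \<open>The difference is written as a sum so that \<open>engel_X_add\<close>
    matches.\<close>
  have "engel_X 2 (\<lambda>p. - engel_X 3 f p + - engel_X 1 (engel_X 2 f) p) p =
      - engel_X 2 (engel_X 3 f) p - engel_X 2 (engel_X 1 (engel_X 2 f)) p"
    by (subst engel_X_add; (intro s)?) (simp add: engel_X_minus s)
  moreover have "engel_X 1 (\<lambda>p. - engel_X 2 (engel_X 2 f) p) p = - engel_X 1 (engel_X 2 (engel_X 2 f)) p"
    by (intro engel_X_minus s)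
  ultimately show ?thesis
    using engel_X_commutators(1)[OF smooth_engel_X[OF f, of 2], of p]
      engel_X_commutators(4)[OF f, of p] by simp
qed

text \<open>The second coordinate is additive under \<open>engel_mult\<close>, hence grows at unit
  speed along the flow of X_2.\<close>

lemma engel_X_2_surj:
  assumes "smooth h"
  obtains f where "smooth f" "engel_X 2 f = h"
proof
  let ?f = "flow_integral (axis 2 1) (\<lambda>p. p$2) h"
  show "smooth ?f"
    by (intro smooth_flow_integral assms smooth_nth bounded_linear_ident)
  show "engel_X 2 ?f = h"
    unfolding engel_X_def
    by (intro ext left_inv_field_flow_integral assms)
      (simp add: engel_mult_def axis_def)
qed

lemma engel_X_3_surj_on_kernel:
  assumes g: "smooth g" "\<And>p. engel_X 2 g p = 0"
  obtains f where "smooth f" "engel_X 3 f = g" "engel_X 2 f = (\<lambda>p. 0)"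
proof
  \<comment> \<open>The flow of X_2 for time \<open>t\<close> adds \<open>t\<close> to
    \<open>p$2\<close> and \<open>t * p$1 / 2\<close> to \<open>p$3\<close>, so the correction makes
    \<open>?q\<close> invariant. The flow of X_3 fixes \<open>p$1\<close> and \<open>p$2\<close> and
    adds \<open>t\<close> to \<open>p$3\<close>, so \<open>?q\<close> has unit speed there.\<close>
  let ?q = "\<lambda>p::engel. p$3 - 1/2 * (p$1 * p$2)"
  let ?f = "flow_integral (axis 3 1) ?q g"
  show "smooth ?f"
    by (intro smooth_flow_integral g smooth_intros smooth_nth bounded_linear_ident)
  show "engel_X 3 ?f = g"
    unfolding engel_X_def
    by (intro ext left_inv_field_flow_integral g)
      (simp add: engel_mult_def axis_def)
  show "engel_X 2 ?f = (\<lambda>p. 0)"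
    unfolding engel_X_def
  proof (intro ext left_inv_field_flow_integral_commuting bracket_basis)
    show "g (engel_mult p (t *\<^sub>R axis 2 1)) = g p" for p t
      using left_inv_field_eq_0_imp_invariant[OF g(1)] g(2) by (simp add: engel_X_def)
  qed (simp add: engel_mult_def axis_def algebra_simps)
qed

lemma engel_system_solvable:
  assumes g: "smooth g" and h: "smooth h" and gh: "engel_X 2 g = engel_X 1 h"
  obtains f where "smooth f" "g = (\<lambda>p. - engel_X 3 f p - engel_X 1 (engel_X 2 f) p)"
    "h = (\<lambda>p. - engel_X 2 (engel_X 2 f) p)"
proof -
  obtain u where u: "smooth u" "engel_X 2 u = (\<lambda>p. - h p)"
    using engel_X_2_surj[OF smooth_minus[OF h]] .
  obtain f\<^sub>0 where f\<^sub>0: "smooth f\<^sub>0" "engel_X 2 f\<^sub>0 = u"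
    using engel_X_2_surj[OF u(1)] .
  define k where "k p = - engel_X 3 f\<^sub>0 p - engel_X 1 u p" for p
  have k: "smooth k"
    unfolding k_def by (intro smooth_intros smooth_engel_X f\<^sub>0 u)
  \<comment> \<open>As \<open>f\<^sub>0\<close> solves the second equation, compatibility gives X_2
    k = X_1 h, which is X_2 g by assumption.\<close>
  have "engel_X 2 k p = engel_X 2 g p" for p
    using engel_system_compatible[OF f\<^sub>0(1), of p] by (simp add: f\<^sub>0 u gh k_def[abs_def])
  then have X2_defect: "engel_X 2 (\<lambda>p. k p + - g p) p = 0" for p
    by (subst engel_X_add; (intro k smooth_minus g)?) (simp add: engel_X_minus g)
  have "smooth (\<lambda>p. k p + - g p)"
    by (intro smooth_intros k g)
  then obtain a where a: "smooth a" "engel_X 3 a = (\<lambda>p. k p + - g p)"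
      "engel_X 2 a = (\<lambda>p. 0)"
    using engel_X_3_surj_on_kernel[OF _ X2_defect] by blast
  let ?f = "\<lambda>p. f\<^sub>0 p + a p"
  \<comment> \<open>Because X_2 a = 0, adding \<open>a\<close> keeps the second equation and the
    term X_1 X_2 of the first; only the X_3 term changes, by exactly the defect.\<close>
  have X2: "engel_X 2 ?f = u"
    using a f\<^sub>0 by (simp add: fun_eq_iff engel_X_add)
  have X3: "engel_X 3 ?f p = engel_X 3 f\<^sub>0 p + k p - g p" for p
    using a f\<^sub>0 by (simp add: engel_X_add)
  show ?thesis
  proof
    show "smooth ?f"
      by (intro smooth_add f\<^sub>0 a)
  qed (auto simp: X2 X3 u k_def)
qed

theorem lemma2p26:
  shows "{(\<lambda>p. - engel_X 3 f p - engel_X 1 (engel_X 2 f) p, \<lambda>p. - engel_X 2 (engel_X 2 f) p)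
            | f. smooth f}
       = {(g, h). smooth g \<and> smooth h \<and> engel_X 2 g = engel_X 1 h}"
proof (intro equalityI subsetI)
  fix z assume "z \<in> {(\<lambda>p. - engel_X 3 f p - engel_X 1 (engel_X 2 f) p,
    \<lambda>p. - engel_X 2 (engel_X 2 f) p) | f. smooth f}"
  then show "z \<in> {(g, h). smooth g \<and> smooth h \<and> engel_X 2 g = engel_X 1 h}"
    using engel_system_compatible
    by (auto intro!: smooth_intros smooth_engel_X)
next
  fix z assume "z \<in> {(g, h). smooth g \<and> smooth h \<and> engel_X 2 g = engel_X 1 h}"
  then obtain g h where z: "z = (g, h)" "smooth g" "smooth h" "engel_X 2 g = engel_X 1 h"
    by auto
  show "z \<in> {(\<lambda>p. - engel_X 3 f p - engel_X 1 (engel_X 2 f) p,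
    \<lambda>p. - engel_X 2 (engel_X 2 f) p) | f. smooth f}"
    using engel_system_solvable[OF z(2-4)] z(1) by blast
qed

end
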